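(* Let $\mathbb{Y}$ be a two-dimensional real polygonal Banach space. Then the pair $(\ell_{\infty}^4,\mathbb{Y})$ satisfies the weak L-P property.
   Context: All Banach spaces are real; $\ell_\infty^4$ is $\mathbb{R}^4$ with the maximum norm. $B_{\mathbb{X}}$ is the closed unit ball of $\mathbb{X}$ and $Ext(A)$ is the set of extreme points of a convex set $A$. A two-dimensional Banach space is polygonal if its closed unit ball has only finitely many extreme points. $\mathbb{L}(\mathbb{X},\mathbb{Y})$ is the space of bounded linear operators with the operator norm; an operator $T$ is an extreme contraction if it is an extreme point of the closed unit ball of $\mathbb{L}(\mathbb{X},\mathbb{Y})$. The pair $(\mathbb{X},\mathbb{Y})$ has the weak L-P property if for each extreme contraction $T\in\mathbb{L}(\mathbb{X},\mathbb{Y})$ with $\|T\|=1$ one has $T(Ext(B_{\mathbb{X}}))\cap Ext(B_{\mathbb{Y}})\neq\emptyset$. *)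

theory Defs
  imports "HOL-Analysis.Analysis"
begin

text \<open>
  The Banach space \<open>\<ell>\<^sub>\<infinity>\<^sup>n\<close>. The type \<open>real ^ 'n\<close> already carries the Euclidean
  norm, so the maximum norm is put on a copy of it. \<open>\<ell>\<^sub>\<infinity>\<^sup>4\<close> is the type \<open>4 linf\<close>.
\<close>

typedef 'n linf = "UNIV :: (real ^ 'n) set"
  morphisms coords of_coords by simp

lemmas linf_simps [simp] = of_coords_inverse [OF UNIV_I] coords_inverse

lemma linf_eqI: "(\<And>i. coords x $ i = coords y $ i) \<Longrightarrow> x = y"
  by (metis coords_inverse vec_eq_iff)

instantiation linf :: (finite) real_normed_vector
begin

definition zero_linf :: "'a linf" where "0 = of_coords 0"
definition plus_linf :: "'a linf \<Rightarrow> 'a linf \<Rightarrow> 'a linf"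
  where "x + y = of_coords (coords x + coords y)"
definition minus_linf :: "'a linf \<Rightarrow> 'a linf \<Rightarrow> 'a linf"
  where "x - y = of_coords (coords x - coords y)"
definition uminus_linf :: "'a linf \<Rightarrow> 'a linf"
  where "- x = of_coords (- coords x)"
definition scaleR_linf :: "real \<Rightarrow> 'a linf \<Rightarrow> 'a linf"
  where "r *\<^sub>R x = of_coords (r *\<^sub>R coords x)"
definition norm_linf :: "'a linf \<Rightarrow> real"
  where "norm x = Max (range (\<lambda>i. \<bar>coords x $ i\<bar>))"
definition sgn_linf :: "'a linf \<Rightarrow> 'a linf"
  where "sgn (x :: 'a linf) = inverse (norm x) *\<^sub>R x"
definition dist_linf :: "'a linf \<Rightarrow> 'a linf \<Rightarrow> real"
  where "dist x y = norm (x - y :: 'a linf)"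
definition uniformity_linf :: "('a linf \<times> 'a linf) filter"
  where "uniformity = (INF e\<in>{0<..}. principal {(x, y). dist (x :: 'a linf) y < e})"
definition open_linf :: "'a linf set \<Rightarrow> bool"
  where "open (U :: 'a linf set) \<longleftrightarrow> (\<forall>x\<in>U. eventually (\<lambda>(x', y). x' = x \<longrightarrow> y \<in> U) uniformity)"

lemma norm_linf_le_iff: "norm (x :: 'a linf) \<le> c \<longleftrightarrow> (\<forall>i. \<bar>coords x $ i\<bar> \<le> c)"
  unfolding norm_linf_def by (subst Max_le_iff) auto

lemma coord_le_norm_linf: "\<bar>coords x $ i\<bar> \<le> norm (x :: 'a linf)"
  using norm_linf_le_iff by blast

lemma norm_linf_attained: "\<exists>i. norm (x :: 'a linf) = \<bar>coords x $ i\<bar>"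
proof -
  have "norm x \<in> range (\<lambda>i. \<bar>coords x $ i\<bar>)"
    unfolding norm_linf_def by (rule Max_in) auto
  then show ?thesis by auto
qed

instance
proof
  fix a b :: real and x y z :: "'a linf"
  show "x + y + z = x + (y + z)" "x + y = y + x" "0 + x = x" "- x + x = 0" "x - y = x + - y"
    by (simp_all add: plus_linf_def zero_linf_def uminus_linf_def minus_linf_def add_ac)
  show "a *\<^sub>R (x + y) = a *\<^sub>R x + a *\<^sub>R y" "(a + b) *\<^sub>R x = a *\<^sub>R x + b *\<^sub>R x"
    "a *\<^sub>R b *\<^sub>R x = (a * b) *\<^sub>R x" "1 *\<^sub>R x = x"
    by (simp_all add: plus_linf_def scaleR_linf_def algebra_simps)
  show "dist x y = norm (x - y)" by (fact dist_linf_def)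
  show "sgn x = inverse (norm x) *\<^sub>R x" by (fact sgn_linf_def)
  show "uniformity = (INF e\<in>{0<..}. principal {(x, y). dist (x :: 'a linf) y < e})"
    by (fact uniformity_linf_def)
  show "open U \<longleftrightarrow> (\<forall>x\<in>U. eventually (\<lambda>(x', y). x' = x \<longrightarrow> y \<in> U) uniformity)"
    for U :: "'a linf set"
    by (fact open_linf_def)
  show "norm x = 0 \<longleftrightarrow> x = 0"
  proof
    assume "norm x = 0"
    then show "x = 0"
      using coord_le_norm_linf[of x] by (intro linf_eqI) (simp add: zero_linf_def)
  next
    assume "x = 0"
    then show "norm x = 0"
      using norm_linf_attained[of x] by (auto simp: zero_linf_def)
  qed
  show "norm (x + y) \<le> norm x + norm y"
  proof (unfold norm_linf_le_iff, rule allI)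
    fix i
    show "\<bar>coords (x + y) $ i\<bar> \<le> norm x + norm y"
      using coord_le_norm_linf[of x i] coord_le_norm_linf[of y i] by (simp add: plus_linf_def)
  qed
  show "norm (a *\<^sub>R x) = \<bar>a\<bar> * norm x"
  proof (rule antisym)
    show "norm (a *\<^sub>R x) \<le> \<bar>a\<bar> * norm x"
      unfolding norm_linf_le_iff
      by (simp add: scaleR_linf_def abs_mult mult_left_mono coord_le_norm_linf)
    obtain i where "norm x = \<bar>coords x $ i\<bar>"
      using norm_linf_attained by blast
    then show "\<bar>a\<bar> * norm x \<le> norm (a *\<^sub>R x)"
      using coord_le_norm_linf[of "a *\<^sub>R x" i] by (simp add: scaleR_linf_def abs_mult)
  qed
qed

end

instance linf :: (finite) banach
proof
  fix X :: "nat \<Rightarrow> 'a linf"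
  assume X: "Cauchy X"
  have "Cauchy (\<lambda>n. coords (X n) $ i)" for i
  proof (rule metric_CauchyI)
    fix e :: real assume "0 < e"
    then obtain M where M: "\<And>m n. m \<ge> M \<Longrightarrow> n \<ge> M \<Longrightarrow> norm (X m - X n) < e"
      using CauchyD[OF X] by blast
    have "dist (coords (X m) $ i) (coords (X n) $ i) \<le> norm (X m - X n)" for m n
      using coord_le_norm_linf[of "X m - X n" i] by (simp add: minus_linf_def dist_real_def)
    then show "\<exists>M. \<forall>m\<ge>M. \<forall>n\<ge>M. dist (coords (X m) $ i) (coords (X n) $ i) < e"
      using M by (meson le_less_trans)
  qed
  then have "\<exists>l. (\<lambda>n. coords (X n) $ i) \<longlonglongrightarrow> l" for i
    by (simp add: Cauchy_convergent_iff convergent_def)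
  then obtain l where l: "\<And>i. (\<lambda>n. coords (X n) $ i) \<longlonglongrightarrow> l i"
    by metis
  define L where "L = of_coords (\<chi> i. l i)"
  have "X \<longlonglongrightarrow> L"
  proof (rule LIMSEQ_I)
    fix e :: real assume e: "0 < e"
    have "\<forall>\<^sub>F n in sequentially. \<forall>i. \<bar>coords (X n) $ i - l i\<bar> < e"
      using tendstoD[OF l e] by (simp add: eventually_all_finite dist_real_def)
    then obtain N where N: "\<And>n i. n \<ge> N \<Longrightarrow> \<bar>coords (X n) $ i - l i\<bar> < e"
      by (auto simp: eventually_sequentially)
    have "norm (X n - L) < e" if "n \<ge> N" for n
      using norm_linf_attained[of "X n - L"] N[OF that] by (auto simp: minus_linf_def L_def)
    then show "\<exists>N. \<forall>n\<ge>N. norm (X n - L) < e" by blast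
  qed
  then show "convergent X" by (auto simp: convergent_def)
qed

definition Ext :: "'a::real_vector set \<Rightarrow> 'a set"
  where "Ext A = {x. x extreme_point_of A}"

text \<open>
  Spaces are passed as types. A space whose dimension is infinite has \<open>dim UNIV = 0\<close>,
  so \<open>dim UNIV = 2\<close> does express two-dimensionality.
\<close>

definition polygonal :: "'a::banach itself \<Rightarrow> bool"
  where "polygonal _ \<longleftrightarrow> dim (UNIV :: 'a set) = 2 \<and> finite (Ext (cball (0 :: 'a) 1))"

definition extreme_contraction ::
  "('a::real_normed_vector \<Rightarrow>\<^sub>L 'b::real_normed_vector) \<Rightarrow> bool"
  where "extreme_contraction T \<longleftrightarrow> T \<in> Ext (cball 0 1)"

definition weak_LP_property :: "'a::banach itself \<Rightarrow> 'b::banach itself \<Rightarrow> bool"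
  where "weak_LP_property _ _ \<longleftrightarrow>
    (\<forall>T :: 'a \<Rightarrow>\<^sub>L 'b. extreme_contraction T \<and> norm T = 1 \<longrightarrow>
      blinfun_apply T ` Ext (cball 0 1) \<inter> Ext (cball 0 1) \<noteq> {})"

end

theory Submission
  imports Defs
begin

text \<open>
  Suppose that no vertex \<open>v\<close> of the cube is mapped to an extreme point, so that for each \<open>v\<close> there
  is a direction \<open>d v \<noteq> 0\<close> with \<open>T v \<plusminus> d v\<close> in the unit ball. If \<open>T\<close> is an extreme contraction,
  an operator \<open>U\<close> vanishes as soon as, for each pair \<open>\<plusminus>v\<close> with \<open>\<parallel>T v\<parallel> = 1\<close>, the vector \<open>U v\<close> is a
  multiple of \<open>d v\<close>. This is one linear equation per pair of vertices; there are 8 pairs and the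
  space of operators has dimension 8, so \<open>\<parallel>T v\<parallel> = 1\<close> at every vertex.

  A linear relation among the images of the basis vectors, with nonzero coefficients at two indices
  \<open>i \<noteq> j\<close>, then yields a two-dimensional face of the cube (in the directions \<open>i\<close>, \<open>j\<close>) whose centre
  has an image of norm 1. This forces the directions \<open>d s\<close> at the four vertices \<open>s\<close> of the face to
  be parallel. With \<open>k\<close>, \<open>l\<close> the other two indices and \<open>v\<close> a vertex of the face, the operator
  \<open>U x = (v\<^sub>k x\<^sub>k + v\<^sub>l x\<^sub>l) d v\<close> vanishes at every vertex outside the face and its negative, so \<open>U = 0\<close>
  by the above, a contradiction.
\<close>

section \<open>Extreme points and symmetric perturbations\<close>

lemma extreme_point_of_symmetric_perturbation:
  assumes "x extreme_point_of S" "x + d \<in> S" "x - d \<in> S"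
  shows "d = 0"
proof (rule ccontr)
  assume "d \<noteq> 0"
  then have "x + d \<noteq> x - d" by (simp add: eq_neg_iff_add_eq_0 flip: scaleR_2)
  moreover have "x = midpoint (x + d) (x - d)"
    by (simp add: midpoint_def flip: scaleR_2)
  ultimately have "x \<in> open_segment (x + d) (x - d)"
    by (metis midpoint_in_open_segment)
  with assms show False by (auto simp: extreme_point_of_def)
qed

lemma not_extreme_point_of_imp_perturbation:
  assumes "convex S" "x \<in> S" "\<not> x extreme_point_of S"
  obtains d where "d \<noteq> 0" "x + d \<in> S" "x - d \<in> S"
proof -
  obtain a b where ab: "a \<in> S" "b \<in> S" "x \<in> open_segment a b"
    using assms by (auto simp: extreme_point_of_def)
  then obtain u where u: "0 < u" "u < 1" "x = (1 - u) *\<^sub>R a + u *\<^sub>R b" and "a \<noteq> b"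
    by (auto simp: in_segment)
  \<comment> \<open>The largest step for which the parameters \<open>u + m\<close> and
    \<open>u - m\<close> both stay in [0, 1].\<close>
  define m where "m = min u (1 - u)"
  have m: "0 < m" "m \<le> u" "m \<le> 1 - u" using u by (auto simp: m_def)
  show thesis
  proof
    show "m *\<^sub>R (b - a) \<noteq> 0" using m \<open>a \<noteq> b\<close> by simp
    have "x + m *\<^sub>R (b - a) = (1 - (u + m)) *\<^sub>R a + (u + m) *\<^sub>R b"
      "x - m *\<^sub>R (b - a) = (1 - (u - m)) *\<^sub>R a + (u - m) *\<^sub>R b"
      by (simp_all add: u algebra_simps)
    then show "x + m *\<^sub>R (b - a) \<in> S" "x - m *\<^sub>R (b - a) \<in> S"
      using m u ab convexD_alt[OF assms(1) ab(1,2)] by simp_all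
  qed
qed

section \<open>Linear algebra in a two-dimensional space\<close>

text \<open>The value 2 rules out the default 0 in \<open>dim_def\<close>, so the basis chosen there
  exists and has two elements.\<close>

lemma dim_eq_2_basis:
  assumes "dim (UNIV :: 'b set) = 2"
  obtains B :: "'b::real_vector set" where "independent B" "span B = UNIV" "card B = 2"
proof -
  have "\<exists>B :: 'b set. independent B \<and> span B = span UNIV"
    using assms unfolding dim_def by (metis zero_neq_numeral)
  from someI_ex[OF this] that assms show thesis
    unfolding dim_def by (simp split: if_splits)
qed

text \<open>A vector outside the span of \<open>d\<close> and \<open>e\<close> would give three
  independent vectors in the span of a two-element basis.\<close>

lemma two_dim_span:
  fixes d e :: "'b::real_vector"
  assumes dim: "dim (UNIV :: 'b set) = 2" and d: "d \<noteq> 0" and e: "e \<notin> range (\<lambda>c. c *\<^sub>R d)"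
  obtains \<alpha> \<beta> where "y = \<alpha> *\<^sub>R d + \<beta> *\<^sub>R e"
proof -
  obtain B :: "'b set" where B: "independent B" "span B = UNIV" "card B = 2"
    using dim_eq_2_basis[OF dim] by blast
  have "finite B" using B(3) card.infinite by fastforce
  have "e \<notin> span {d}" using e by (auto simp: span_singleton)
  then have ne: "e \<noteq> d" and ind: "independent {e, d}"
    using d by (auto simp: span_base independent_insert)
  have "y \<in> span {e, d}"
  proof (rule ccontr)
    assume y: "y \<notin> span {e, d}"
    then have "independent (insert y {e, d})" by (rule independent_insertI[OF _ ind])
    then have "card (insert y {e, d}) \<le> card B"
      using independent_span_bound[OF \<open>finite B\<close>] B by blast
    moreover have "y \<notin> {e, d}" using y by (auto intro: span_base)
    ultimately show False using ne B by simp
  qed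
  then obtain \<alpha> \<beta> where "y - \<beta> *\<^sub>R e = \<alpha> *\<^sub>R d"
    by (auto simp: span_breakdown_eq[of y e] span_singleton)
  then have "y = \<alpha> *\<^sub>R d + \<beta> *\<^sub>R e" by (simp add: diff_eq_eq)
  then show thesis by (rule that)
qed

lemma two_dim_basis:
  assumes "dim (UNIV :: 'b set) = 2"
  obtains d e :: "'b::real_vector" where "d \<noteq> 0" "e \<notin> range (\<lambda>c. c *\<^sub>R d)"
proof -
  obtain B :: "'b set" where B: "independent B" "span B = UNIV" "card B = 2"
    using dim_eq_2_basis[OF assms] by blast
  then obtain d e where de: "B = {d, e}" "d \<noteq> e" by (auto simp: card_2_iff)
  then have "d \<noteq> 0" using B(1) dependent_zero by blast
  moreover have "e \<notin> span {d}"
    using B(1) de by (metis dependent_def insert_iff insert_Diff_if insert_absorb2 Diff_insert_absorb singletonD)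
  ultimately show thesis using that by (auto simp: span_singleton)
qed

section \<open>Norms along segments and parallelograms\<close>

lemma norm_add_scaleR_le:
  fixes p d :: "'b::real_normed_vector"
  assumes "norm (p + d) \<le> r" "norm (p - d) \<le> r" "\<bar>t\<bar> \<le> 1"
  shows "norm (p + t *\<^sub>R d) \<le> r"
proof -
  have "p + t *\<^sub>R d = (1 - (1 - t) / 2) *\<^sub>R (p + d) + ((1 - t) / 2) *\<^sub>R (p - d)"
  proof -
    define u where "u = (1 - t) / 2"
    have "(1 - u) *\<^sub>R (p + d) + u *\<^sub>R (p - d) = p + d - u *\<^sub>R d - u *\<^sub>R d"
      by (simp add: algebra_simps)
    also have "\<dots> = p + (1 - (u + u)) *\<^sub>R d"
      by (simp only: scaleR_diff_left scaleR_add_left) simp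
    finally show ?thesis by (simp add: u_def)
  qed
  then have "p + t *\<^sub>R d \<in> cball 0 r"
    using convexD_alt[OF convex_cball, of "p + d" 0 r "p - d" "(1 - t) / 2"] assms by simp
  then show ?thesis by simp
qed

text \<open>The sum of the segments \<open>p \<plusminus> d\<close> and \<open>q \<plusminus> e\<close> is a parallelogram centred at \<open>p + q\<close>,
  so \<open>(p + q) / 2\<close> is an interior point of the unit ball.\<close>

lemma norm_add_less_2:
  fixes p q d e :: "'b::real_normed_vector"
  assumes p: "norm (p + d) \<le> 1" "norm (p - d) \<le> 1"
    and q: "norm (q + e) \<le> 1" "norm (q - e) \<le> 1"
    and pq: "p + q = \<alpha> *\<^sub>R d + \<beta> *\<^sub>R e"
  shows "norm (p + q) < 2"
proof -
  \<comment> \<open>Small enough that stretching \<open>p + q\<close> by \<open>1 + \<delta>\<close>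
    stays within the parallelogram.\<close>
  define \<delta> where "\<delta> = 1 / (1 + \<bar>\<alpha>\<bar> + \<bar>\<beta>\<bar>)"
  have \<delta>: "\<delta> > 0" "\<bar>\<delta> * \<alpha>\<bar> \<le> 1" "\<bar>\<delta> * \<beta>\<bar> \<le> 1"
    by (auto simp: \<delta>_def abs_mult field_simps)
  have "(1 + \<delta>) *\<^sub>R (p + q) = (p + q) + \<delta> *\<^sub>R (\<alpha> *\<^sub>R d + \<beta> *\<^sub>R e)"
    by (simp add: scaleR_add_left flip: pq)
  also have "\<dots> = (p + (\<delta> * \<alpha>) *\<^sub>R d) + (q + (\<delta> * \<beta>) *\<^sub>R e)"
    by (simp add: algebra_simps)
  finally have "norm ((1 + \<delta>) *\<^sub>R (p + q)) \<le> 1 + 1"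
    using norm_triangle_mono[OF norm_add_scaleR_le[OF p \<delta>(2)] norm_add_scaleR_le[OF q \<delta>(3)]]
    by (simp only:)
  then have le: "(1 + \<delta>) * norm (p + q) \<le> 2" using \<delta> by simp
  show ?thesis
  proof (rule ccontr)
    assume "\<not> norm (p + q) < 2"
    then have "(1 + \<delta>) * 2 \<le> (1 + \<delta>) * norm (p + q)"
      using \<delta> by (intro mult_left_mono) auto
    with le \<delta> show False by simp
  qed
qed

section \<open>Vertices of the cube\<close>

definition sign_vectors :: "(real ^ 'n) set"
  where "sign_vectors = {v. \<forall>i. v $ i = 1 \<or> v $ i = - 1}"

lemma sign_vectorsD: "v \<in> sign_vectors \<Longrightarrow> v $ i = 1 \<or> v $ i = - 1"
  by (simp add: sign_vectors_def)

lemma uminus_sign_vectors: "v \<in> sign_vectors \<Longrightarrow> - v \<in> sign_vectors"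
  by (force simp: sign_vectors_def)

text \<open>Coding a vertex by its set of positive coordinates reduces finiteness and counting to
  power sets.\<close>

definition sign_vector :: "'n set \<Rightarrow> real ^ 'n"
  where "sign_vector \<sigma> = (\<chi> i. if i \<in> \<sigma> then 1 else - 1)"

lemma sign_vectors_eq_sign_vector:
  assumes "v \<in> sign_vectors" shows "v = sign_vector {i. v $ i = 1}"
  using sign_vectorsD[OF assms] by (auto simp: sign_vector_def vec_eq_iff)

lemma finite_sign_vectors: "finite (sign_vectors :: (real ^ 'n) set)"
proof (rule finite_subset)
  show "(sign_vectors :: (real ^ 'n) set) \<subseteq> range sign_vector"
    using sign_vectors_eq_sign_vector by blast
qed simp

text \<open>Fixing one coordinate selects one vertex from each antipodal pair; such a vertex is
  coded by a subset of the other coordinates.\<close>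

lemma card_sign_vectors_half:
  "card {v \<in> sign_vectors :: (real ^ 'n) set. v $ k = 1} \<le> 2 ^ (CARD('n) - 1)"
proof -
  have "{v \<in> sign_vectors :: (real ^ 'n) set. v $ k = 1}
      \<subseteq> (\<lambda>\<sigma>. sign_vector (insert k \<sigma>)) ` Pow (UNIV - {k})"
  proof
    fix v :: "real ^ 'n" assume v: "v \<in> {v \<in> sign_vectors. v $ k = 1}"
    then have "insert k ({i. v $ i = 1} - {k}) = {i. v $ i = 1}" by auto
    then have "v = sign_vector (insert k ({i. v $ i = 1} - {k}))"
      using v sign_vectors_eq_sign_vector[of v] by simp
    then show "v \<in> (\<lambda>\<sigma>. sign_vector (insert k \<sigma>)) ` Pow (UNIV - {k})" by blast
  qed
  then have "card {v \<in> sign_vectors :: (real ^ 'n) set. v $ k = 1} \<le> card (Pow (UNIV - {k}))"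
    by (intro surj_card_le) auto
  then show ?thesis by (simp add: card_Pow card_Diff_singleton)
qed

text \<open>Induction on the number of coordinates other than 1 and -1: replacing one of them by 1
  and by -1 gives two points whose segment contains \<open>x\<close>.\<close>

lemma cube_subset_convex:
  fixes x :: "real ^ 'n"
  assumes "convex C" "sign_vectors \<subseteq> C" "\<And>i. \<bar>x $ i\<bar> \<le> 1"
  shows "x \<in> C"
  using assms(3)
proof (induction "card {i. \<bar>x $ i\<bar> \<noteq> 1}" arbitrary: x)
  case 0
  then have "\<bar>x $ i\<bar> = 1" for i by auto
  then have "x \<in> sign_vectors" by (simp add: sign_vectors_def abs_eq_iff')
  then show ?case using assms by blast
next
  case (Suc n)
  then obtain i where i: "\<bar>x $ i\<bar> \<noteq> 1"
    by (metis (mono_tags) card.empty Collect_empty_eq nat.distinct(1))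
  define y where "y c = (\<chi> j. if j = i then c else x $ j)" for c
  have y: "y c \<in> C" if "\<bar>c\<bar> = 1" for c
  proof (rule Suc.hyps(1))
    have "{j. \<bar>y c $ j\<bar> \<noteq> 1} = {j. \<bar>x $ j\<bar> \<noteq> 1} - {i}"
      using that by (auto simp: y_def)
    then show "n = card {j. \<bar>y c $ j\<bar> \<noteq> 1}"
      using i Suc.hyps(2) by (simp add: card_Diff_singleton)
    show "\<bar>y c $ j\<bar> \<le> 1" for j using that Suc.prems by (simp add: y_def)
  qed
  have "x = (1 - (1 - x $ i) / 2) *\<^sub>R y 1 + ((1 - x $ i) / 2) *\<^sub>R y (- 1)"
    by (simp add: vec_eq_iff y_def field_simps)
  moreover have "\<bar>x $ i\<bar> \<le> 1" by (rule Suc.prems)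
  ultimately show ?case
    using convexD_alt[OF assms(1) y[of 1] y[of "- 1"], of "(1 - x $ i) / 2"] by simp
qed

section \<open>Operators on the maximum-norm space, in coordinates\<close>

lemma of_coords_add: "of_coords (x + y) = of_coords x + of_coords (y :: real ^ 'n)"
  by (simp add: plus_linf_def)

lemma of_coords_scaleR: "of_coords (c *\<^sub>R x) = c *\<^sub>R of_coords (x :: real ^ 'n)"
  by (simp add: scaleR_linf_def)

lemma linear_blinfun_of_coords:
  "linear (\<lambda>x :: real ^ 'n. blinfun_apply T (of_coords x))"
  by (rule linearI) (simp_all add: of_coords_add of_coords_scaleR blinfun.add_right blinfun.scaleR_right)

lemma linear_eq_sum_axis:
  fixes L :: "real ^ 'n \<Rightarrow> 'b::real_vector"
  assumes "linear L"
  shows "L x = (\<Sum>i\<in>UNIV. x $ i *\<^sub>R L (axis i 1))"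
proof -
  have "L x = L (\<Sum>i\<in>UNIV. x $ i *\<^sub>R axis i 1)"
    by (simp add: basis_expansion flip: scalar_mult_eq_scaleR)
  then show ?thesis using assms by (simp add: linear_sum linear_scale)
qed

text \<open>The norms of the images of the basis vectors add up to a bound. Perturbations of an
  operator can thus be given as linear maps on coordinates.\<close>

lemma linear_imp_linf_blinfun:
  fixes U :: "real ^ 'n \<Rightarrow> 'b::real_normed_vector"
  assumes "linear U"
  obtains D where "\<And>x. blinfun_apply D (of_coords x) = U x"
proof -
  have "bounded_linear (\<lambda>x. U (coords x))"
  proof (rule bounded_linear_intro)
    show "U (coords (x + y)) = U (coords x) + U (coords y)" for x y
      using assms by (simp add: plus_linf_def linear_add)
    show "U (coords (r *\<^sub>R x)) = r *\<^sub>R U (coords x)" for r x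
      using assms by (simp add: scaleR_linf_def linear_scale)
    show "norm (U (coords x)) \<le> norm x * (\<Sum>i\<in>UNIV. norm (U (axis i 1)))" for x
      unfolding linear_eq_sum_axis[OF assms, of "coords x"] sum_distrib_left
      by (rule sum_norm_le) (simp add: mult_right_mono coord_le_norm_linf)
  qed
  then show thesis
    using that[of "Blinfun (\<lambda>x. U (coords x))"] by (simp add: bounded_linear_Blinfun_apply)
qed

text \<open>The preimage of the unit ball is convex, so it contains the cube once it contains the
  vertices.\<close>

lemma norm_linf_blinfun_le_1:
  fixes T :: "'n::finite linf \<Rightarrow>\<^sub>L 'b::real_normed_vector"
  assumes "\<And>v. v \<in> sign_vectors \<Longrightarrow> norm (T (of_coords v)) \<le> 1"
  shows "norm T \<le> 1"
proof (rule norm_blinfun_bound)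
  fix x :: "'n linf"
  have lin: "linear (\<lambda>x. T (of_coords x))" by (rule linear_blinfun_of_coords)
  show "norm (T x) \<le> 1 * norm x"
  proof (cases "x = 0")
    case False
    have "coords x /\<^sub>R norm x \<in> (\<lambda>x. T (of_coords x)) -` cball 0 1"
    proof (rule cube_subset_convex)
      show "convex ((\<lambda>x. T (of_coords x)) -` cball 0 1)"
        by (rule convex_linear_vimage[OF lin convex_cball])
      show "sign_vectors \<subseteq> (\<lambda>x. T (of_coords x)) -` cball 0 1"
        using assms by auto
      show "\<bar>(coords x /\<^sub>R norm x) $ i\<bar> \<le> 1" for i
        using False coord_le_norm_linf[of x i] by (simp add: abs_mult field_simps)
    qed
    then show ?thesis
      using False by (simp add: of_coords_scaleR blinfun.scaleR_right field_simps)
  qed simp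
qed simp

lemma sign_vector_in_Ext:
  assumes v: "v \<in> (sign_vectors :: (real ^ 'n) set)"
  shows "of_coords v \<in> Ext (cball 0 1)"
proof -
  have "norm (of_coords v) \<le> 1"
    using sign_vectorsD[OF v] by (auto simp: norm_linf_le_iff) (metis abs_1 abs_minus_cancel order_refl)
  moreover have False
    if ab: "norm a \<le> 1" "norm b \<le> 1" "of_coords v \<in> open_segment a b" for a b :: "'n linf"
  proof -
    obtain u where u: "0 < u" "u < 1" "of_coords v = (1 - u) *\<^sub>R a + u *\<^sub>R b" and "a \<noteq> b"
      using ab by (auto simp: in_segment)
    have "coords a $ i = coords b $ i" for i
    proof -
      have vi: "v $ i = (1 - u) * coords a $ i + u * coords b $ i"
        using arg_cong[OF u(3), of coords] by (simp add: plus_linf_def scaleR_linf_def)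
      have le: "\<bar>coords a $ i\<bar> \<le> 1" "\<bar>coords b $ i\<bar> \<le> 1"
        using ab by (auto simp: norm_linf_le_iff)
      have nonneg: "(1 - u) * (1 - coords a $ i) \<ge> 0" "(1 - u) * (1 + coords a $ i) \<ge> 0"
        "u * (1 - coords b $ i) \<ge> 0" "u * (1 + coords b $ i) \<ge> 0"
        using le u by auto
      \<comment> \<open>One of the two right-hand sides is 0, so both nonnegative summands on its
        left vanish.\<close>
      have "(1 - u) * (1 - coords a $ i) + u * (1 - coords b $ i) = 1 - v $ i"
        "(1 - u) * (1 + coords a $ i) + u * (1 + coords b $ i) = 1 + v $ i"
        by (simp_all add: vi) (simp_all add: algebra_simps)
      with nonneg have "(1 - u) * (1 - coords a $ i) = 0 \<and> u * (1 - coords b $ i) = 0 \<or>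
         (1 - u) * (1 + coords a $ i) = 0 \<and> u * (1 + coords b $ i) = 0"
        using sign_vectorsD[OF v, of i]
          add_nonneg_eq_0_iff[OF nonneg(1,3)] add_nonneg_eq_0_iff[OF nonneg(2,4)]
        by (metis diff_self add.right_inverse)
      then show ?thesis using u by auto
    qed
    then show False using \<open>a \<noteq> b\<close> linf_eqI by blast
  qed
  ultimately show ?thesis by (auto simp: Ext_def extreme_point_of_def)
qed

section \<open>Solving linear systems by counting dimensions\<close>

lemma linear_two_dim_coordinates:
  fixes L :: "real ^ 'n \<Rightarrow> 'b::real_vector"
  assumes "linear L" and span: "\<And>y. \<exists>\<alpha> \<beta>. y = \<alpha> *\<^sub>R d + \<beta> *\<^sub>R e"
  obtains \<alpha> \<beta> where "\<And>x. L x = (\<alpha> \<bullet> x) *\<^sub>R d + (\<beta> \<bullet> x) *\<^sub>R e"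
proof -
  have "\<forall>i. \<exists>\<alpha> \<beta>. L (axis i 1) = \<alpha> *\<^sub>R d + \<beta> *\<^sub>R e" using span by blast
  then obtain \<alpha> \<beta> where \<alpha>\<beta>: "\<And>i. L (axis i 1) = \<alpha> i *\<^sub>R d + \<beta> i *\<^sub>R e" by metis
  have "L x = ((\<chi> i. \<alpha> i) \<bullet> x) *\<^sub>R d + ((\<chi> i. \<beta> i) \<bullet> x) *\<^sub>R e" for x
    unfolding linear_eq_sum_axis[OF assms(1), of x]
    by (simp add: \<alpha>\<beta> inner_vec_def scaleR_sum_left scaleR_add_right sum.distrib mult.commute)
  then show thesis by (rule that)
qed

lemma exists_nonzero_orthogonal:
  fixes K :: "'a::euclidean_space set"
  assumes "finite K" "card K < DIM('a)"
  obtains x where "x \<noteq> 0" "\<And>k. k \<in> K \<Longrightarrow> k \<bullet> x = 0"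
proof -
  have "dim K < DIM('a)" using dim_le_card'[OF assms(1)] assms(2) by simp
  then obtain x where "x \<noteq> 0" "\<And>y. y \<in> span K \<Longrightarrow> orthogonal x y"
    using orthogonal_to_subspace_exists by blast
  then show thesis using that by (metis orthogonal_def inner_commute span_base)
qed

text \<open>In a basis of the target, an operator is a pair of vectors, with 2n coordinates for n =
  \<open>CARD('n)\<close>. Being parallel to \<open>d v\<close> at \<open>v\<close> is one linear
  equation, so fewer than 2n of them have a nonzero solution.\<close>

lemma exists_linear_parallel:
  fixes d :: "real ^ 'n \<Rightarrow> 'b::real_vector"
  assumes dim: "dim (UNIV :: 'b set) = 2"
    and K: "finite K" "card K < 2 * CARD('n)" and d: "\<And>v. v \<in> K \<Longrightarrow> d v \<noteq> 0"
  obtains U x where "linear U" "U x \<noteq> 0" "\<And>v. v \<in> K \<Longrightarrow> \<exists>c. U v = c *\<^sub>R d v"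
proof -
  obtain b e :: 'b where be: "b \<noteq> 0" "e \<notin> range (\<lambda>c. c *\<^sub>R b)"
    using two_dim_basis[OF dim] by blast
  have span: "\<exists>\<alpha> \<beta>. y = \<alpha> *\<^sub>R b + \<beta> *\<^sub>R e" for y
    using two_dim_span[OF dim be] by blast
  then have "\<forall>v. \<exists>p q. d v = p *\<^sub>R b + q *\<^sub>R e" by blast
  then obtain p q where pq: "\<And>v. d v = p v *\<^sub>R b + q v *\<^sub>R e" by metis
  \<comment> \<open>The inner product of \<open>?k v\<close> with \<open>(\<alpha>, \<beta>)\<close>
    is the determinant of \<open>d v\<close> and \<open>U v\<close> in the basis \<open>b\<close>,
    \<open>e\<close>.\<close>
  let ?k = "\<lambda>v. (- q v *\<^sub>R v, p v *\<^sub>R v)"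
  have "card (?k ` K) < DIM((real ^ 'n) \<times> (real ^ 'n))"
    using card_image_le[OF K(1), of ?k] K(2) by simp
  then obtain z where z: "z \<noteq> 0" "\<And>k. k \<in> ?k ` K \<Longrightarrow> k \<bullet> z = 0"
    using exists_nonzero_orthogonal[OF finite_imageI[OF K(1)]] by blast
  obtain \<alpha> \<beta> where \<alpha>\<beta>: "z = (\<alpha>, \<beta>)" by fastforce
  define U where "U x = (\<alpha> \<bullet> x) *\<^sub>R b + (\<beta> \<bullet> x) *\<^sub>R e" for x
  have zero: "s = 0 \<and> t = 0" if "s *\<^sub>R b + t *\<^sub>R e = 0" for s t
  proof -
    have "t = 0"
    proof (rule ccontr)
      assume "t \<noteq> 0"
      then have "e = (1 / t) *\<^sub>R (t *\<^sub>R e)" by simp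
      also have "t *\<^sub>R e = (- s) *\<^sub>R b" using that by (simp add: add_eq_0_iff)
      finally have "e = (- s / t) *\<^sub>R b" by simp
      with be show False by blast
    qed
    then show ?thesis using that be by simp
  qed
  show thesis
  proof
    show "linear U"
      by (rule linearI) (simp_all add: U_def inner_add_right algebra_simps)
    \<comment> \<open>The first coordinate of \<open>U \<alpha>\<close> and the second of
      \<open>U \<beta>\<close> are squared norms, not both zero.\<close>
    have "U \<alpha> \<noteq> 0 \<or> U \<beta> \<noteq> 0"
      using zero[of "\<alpha> \<bullet> \<alpha>" "\<beta> \<bullet> \<alpha>"] zero[of "\<alpha> \<bullet> \<beta>" "\<beta> \<bullet> \<beta>"] z(1)
      by (auto simp: U_def \<alpha>\<beta> zero_prod_def)
    then show "U (if U \<alpha> \<noteq> 0 then \<alpha> else \<beta>) \<noteq> 0" by auto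
    show "\<exists>c. U v = c *\<^sub>R d v" if v: "v \<in> K" for v
    proof -
      have eq: "p v * (\<beta> \<bullet> v) = q v * (\<alpha> \<bullet> v)"
        using z(2)[of "?k v"] v by (simp add: \<alpha>\<beta> inner_commute)
      have "p v \<noteq> 0 \<or> q v \<noteq> 0" using d[OF v] pq[of v] by auto
      then show ?thesis
      proof
        assume "p v \<noteq> 0"
        then have "U v = ((\<alpha> \<bullet> v) / p v) *\<^sub>R d v"
          using eq by (simp add: U_def pq scaleR_add_right field_simps)
        then show ?thesis by blast
      next
        assume "q v \<noteq> 0"
        then have "U v = ((\<beta> \<bullet> v) / q v) *\<^sub>R d v"
          using eq by (simp add: U_def pq scaleR_add_right field_simps)
        then show ?thesis by blast
      qed
    qed
  qed
qed

text \<open>The kernel is cut out by two equations. With at least four unknowns, adding a third,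
  that the coordinate at \<open>i\<close> is zero, still leaves a nonzero solution.\<close>

lemma exists_kernel_two_nonzero_coordinates:
  fixes L :: "real ^ 'n \<Rightarrow> 'b::real_vector"
  assumes dim: "dim (UNIV :: 'b set) = 2" and "CARD('n) \<ge> 4" and L: "linear L"
  obtains a i j where "i \<noteq> j" "a $ i \<noteq> 0" "a $ j \<noteq> 0" "L a = 0" "\<And>l. \<bar>a $ l\<bar> \<le> 1"
proof -
  obtain b e :: 'b where be: "b \<noteq> 0" "e \<notin> range (\<lambda>c. c *\<^sub>R b)"
    using two_dim_basis[OF dim] by blast
  have span: "\<exists>\<alpha> \<beta>. y = \<alpha> *\<^sub>R b + \<beta> *\<^sub>R e" for y
    using two_dim_span[OF dim be] by blast
  obtain \<alpha> \<beta> where \<alpha>\<beta>: "\<And>x. L x = (\<alpha> \<bullet> x) *\<^sub>R b + (\<beta> \<bullet> x) *\<^sub>R e"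
    using linear_two_dim_coordinates[OF L span] by blast
  have card: "card {\<alpha>, \<beta>, u} < DIM(real ^ 'n)" for u
    using assms(2) card_insert_le_m1[of 3 "{\<beta>, u}" \<alpha>] card_insert_le_m1[of 2 "{u}" \<beta>] by simp
  obtain x where "x \<noteq> 0" and xK: "\<And>k. k \<in> {\<alpha>, \<beta>, 0} \<Longrightarrow> k \<bullet> x = 0"
    using exists_nonzero_orthogonal[OF _ card[of 0]] by blast
  then have x: "x \<noteq> 0" "L x = 0" by (simp_all add: \<alpha>\<beta>)
  then obtain i where i: "x $ i \<noteq> 0" by (auto simp: vec_eq_iff)
  obtain y where "y \<noteq> 0" and yK: "\<And>k. k \<in> {\<alpha>, \<beta>, axis i 1} \<Longrightarrow> k \<bullet> y = 0"
    using exists_nonzero_orthogonal[OF _ card[of "axis i 1"]] by blast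
  then have y: "y \<noteq> 0" "L y = 0" "y $ i = 0"
    using yK[of "axis i 1"] by (simp_all add: \<alpha>\<beta> inner_axis')
  then obtain j where j: "y $ j \<noteq> 0" by (auto simp: vec_eq_iff)
  then have "i \<noteq> j" using y by auto
  \<comment> \<open>Adding \<open>y\<close> repairs the coordinate at \<open>j\<close> and keeps the
    one at \<open>i\<close>, where \<open>y\<close> vanishes.\<close>
  define a where "a = (if x $ j \<noteq> 0 then x else x + y)"
  have a: "a $ i \<noteq> 0" "a $ j \<noteq> 0" "L a = 0"
    using i j x y L by (auto simp: a_def linear_add)
  then have "a \<noteq> 0" by auto
  show thesis
  proof (rule that[of i j "a /\<^sub>R norm a"])
    show "\<bar>(a /\<^sub>R norm a) $ l\<bar> \<le> 1" for l
      using \<open>a \<noteq> 0\<close> component_le_norm_cart[of a l] by (simp add: abs_mult field_simps)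
  qed (use a \<open>a \<noteq> 0\<close> \<open>i \<noteq> j\<close> L in \<open>simp_all add: linear_scale\<close>)
qed

section \<open>Perturbing an extreme contraction, and centres of faces\<close>

text \<open>A small multiple of \<open>U\<close> can be added to \<open>T\<close> or subtracted
  without leaving the unit ball. At a vertex there is room either because the image has norm below 1
  or along the segment given by \<open>d\<close>; one vertex of each antipodal pair suffices by
  symmetry.\<close>

lemma extreme_blinfun_imp_zero:
  fixes T :: "'n::finite linf \<Rightarrow>\<^sub>L 'b::real_normed_vector"
  assumes T: "T extreme_point_of cball 0 1"
    and d: "\<And>v. v \<in> sign_vectors \<Longrightarrow>
      norm (T (of_coords v) + d v) \<le> 1 \<and> norm (T (of_coords v) - d v) \<le> 1"
    and U: "linear U"
    and par: "\<And>v. v \<in> sign_vectors \<Longrightarrow>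
      \<exists>s\<in>{v, - v}. norm (T (of_coords s)) < 1 \<or> (\<exists>c. U s = c *\<^sub>R d s)"
  shows "U x = 0"
proof -
  define L where "L x = T (of_coords x)" for x
  have L: "linear L" unfolding L_def by (rule linear_blinfun_of_coords)
  have "\<exists>\<epsilon>>0. \<forall>t. \<bar>t\<bar> \<le> \<epsilon> \<longrightarrow> norm (L v + t *\<^sub>R U v) \<le> 1" if v: "v \<in> sign_vectors" for v
  proof -
    obtain s where s: "s = v \<or> s = - v"
      and disj: "norm (L s) < 1 \<or> (\<exists>c. U s = c *\<^sub>R d s)"
      using par[OF v] by (auto simp: L_def)
    have sv: "s \<in> sign_vectors" using s v uminus_sign_vectors by blast
    have "\<exists>\<epsilon>>0. \<forall>t. \<bar>t\<bar> \<le> \<epsilon> \<longrightarrow> norm (L s + t *\<^sub>R U s) \<le> 1"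
      using disj
    proof
      assume lt: "norm (L s) < 1"
      \<comment> \<open>The perturbation may use up at most the slack \<open>1 - norm (L s)\<close>;
        the added 1 covers \<open>U s = 0\<close>.\<close>
      define \<epsilon> where "\<epsilon> = (1 - norm (L s)) / (1 + norm (U s))"
      have pos: "1 + norm (U s) > 0" using norm_ge_zero[of "U s"] by linarith
      then have "\<epsilon> > 0" using lt by (simp add: \<epsilon>_def)
      moreover have "norm (L s + t *\<^sub>R U s) \<le> 1" if "\<bar>t\<bar> \<le> \<epsilon>" for t
      proof -
        have "norm (L s + t *\<^sub>R U s) \<le> norm (L s) + \<bar>t\<bar> * norm (U s)"
          by (metis norm_triangle_ineq norm_scaleR)
        also have "\<bar>t\<bar> * norm (U s) \<le> \<epsilon> * (1 + norm (U s))"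
          using that \<open>\<epsilon> > 0\<close> by (intro mult_mono) auto
        also have "\<dots> = 1 - norm (L s)" using pos by (simp add: \<epsilon>_def)
        finally show ?thesis by simp
      qed
      ultimately show ?thesis by blast
    next
      assume "\<exists>c. U s = c *\<^sub>R d s"
      then obtain c where c: "U s = c *\<^sub>R d s" by blast
      have "norm (L s + t *\<^sub>R U s) \<le> 1" if "\<bar>t\<bar> \<le> 1 / (1 + \<bar>c\<bar>)" for t
      proof -
        have "\<bar>t * c\<bar> \<le> 1 / (1 + \<bar>c\<bar>) * (1 + \<bar>c\<bar>)"
          unfolding abs_mult using that by (intro mult_mono) auto
        also have "\<dots> = 1" by (simp add: add_pos_nonneg[THEN less_imp_neq, symmetric])
        finally have "\<bar>t * c\<bar> \<le> 1" .
        then show ?thesis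
          using norm_add_scaleR_le[of "L s" "d s" 1 "t * c"] d[OF sv] by (simp add: c L_def)
      qed
      then show ?thesis by (intro exI[of _ "1 / (1 + \<bar>c\<bar>)"]) auto
    qed
    moreover have "norm (L v + t *\<^sub>R U v) = norm (L s + t *\<^sub>R U s)" for t
      using s L U norm_minus_cancel[of "L v + t *\<^sub>R U v"]
      by (auto simp: linear_neg simp del: norm_minus_cancel)
    ultimately show ?thesis by simp
  qed
  then obtain \<epsilon> where \<epsilon>: "\<And>v. v \<in> sign_vectors \<Longrightarrow> \<epsilon> v > 0"
    "\<And>v t. v \<in> sign_vectors \<Longrightarrow> \<bar>t\<bar> \<le> \<epsilon> v \<Longrightarrow> norm (L v + t *\<^sub>R U v) \<le> 1"
    by metis
  define m where "m = Min (insert 1 (\<epsilon> ` sign_vectors))"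
  have m: "m > 0" using \<epsilon>(1) by (simp add: m_def finite_sign_vectors)
  have m_le: "m \<le> \<epsilon> v" if "v \<in> sign_vectors" for v
    using that by (simp add: m_def finite_sign_vectors)
  obtain D where D: "\<And>x. blinfun_apply D (of_coords x) = U x"
    using linear_imp_linf_blinfun[OF U] by blast
  have bound: "norm (T + t *\<^sub>R D) \<le> 1" if "\<bar>t\<bar> \<le> m" for t
  proof (rule norm_linf_blinfun_le_1)
    fix v :: "real ^ 'n" assume v: "v \<in> sign_vectors"
    then show "norm ((T + t *\<^sub>R D) (of_coords v)) \<le> 1"
      using \<epsilon>(2)[OF v, of t] m_le[OF v] that
      by (simp add: blinfun.add_left blinfun.scaleR_left D L_def)
  qed
  have "m *\<^sub>R D = 0"
    using bound[of m] bound[of "- m"] m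
    by (intro extreme_point_of_symmetric_perturbation[OF T]) simp_all
  then show ?thesis using m D[of x] by simp
qed

text \<open>A linear relation among the images of the basis vectors, with coefficients \<open>a\<close>,
  shows that \<open>L v = L (v - a / 2)\<close>; the point \<open>v - a / 2\<close> is a proper convex combination of the
  centre of a face of the cube and another point of the cube.\<close>

lemma exists_sign_vector_face_centre:
  fixes L :: "real ^ 'n \<Rightarrow> 'b::real_normed_vector"
  assumes L: "linear L" and bound: "\<And>x. (\<And>i. \<bar>x $ i\<bar> \<le> 1) \<Longrightarrow> norm (L x) \<le> 1"
    and vert: "\<And>v. v \<in> sign_vectors \<Longrightarrow> norm (L v) = 1"
    and a: "a $ i \<noteq> 0" "a $ j \<noteq> 0" "L a = 0" "\<And>l. \<bar>a $ l\<bar> \<le> 1"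
  obtains v where "v \<in> sign_vectors"
    "norm (L (\<chi> l. if l = i \<or> l = j then 0 else v $ l)) \<ge> 1"
proof -
  \<comment> \<open>With signs matching those of \<open>a\<close>, subtracting \<open>a / 2\<close>
    moves every coordinate of \<open>v\<close> towards 0.\<close>
  define v :: "real ^ 'n" where "v = (\<chi> l. if a $ l \<ge> 0 then 1 else - 1)"
  have v: "v \<in> sign_vectors" by (simp add: v_def sign_vectors_def)
  define w :: "real ^ 'n" where "w = (\<chi> l. if l = i \<or> l = j then 0 else v $ l)"
  \<comment> \<open>The weight of the face centre \<open>w\<close> in \<open>v - a / 2\<close>. At
    \<open>i\<close> and \<open>j\<close>, where \<open>w\<close> is 0, the shift by
    \<open>a / 2\<close> already gains \<open>m\<close>; elsewhere subtracting
    \<open>m *\<^sub>R w\<close> does. So the rest \<open>r\<close> lies in the cube scaled by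
    \<open>1 - m\<close>.\<close>
  define m where "m = min \<bar>a $ i\<bar> \<bar>a $ j\<bar> / 2"
  have m: "0 < m" "m \<le> \<bar>a $ i\<bar> / 2" "m \<le> \<bar>a $ j\<bar> / 2" "m \<le> 1 / 2"
    using a by (auto simp: m_def min_def)
  define r where "r = v - (1/2) *\<^sub>R a - m *\<^sub>R w"
  have r: "\<bar>r $ l\<bar> \<le> 1 - m" for l
    using m a(4)[of l] by (auto simp: r_def w_def v_def)
  have "norm (L (r /\<^sub>R (1 - m))) \<le> 1"
    using m r by (intro bound) (simp add: abs_mult field_simps)
  then have rle: "norm (L r) \<le> 1 - m"
    using m by (simp add: linear_scale[OF L] field_simps)
  have "v = (1/2) *\<^sub>R a + m *\<^sub>R w + r" by (simp add: r_def)
  then have "L v = m *\<^sub>R L w + L r"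
    by (simp add: linear_add[OF L] linear_scale[OF L] a)
  then have "1 \<le> m * norm (L w) + norm (L r)"
    using vert[OF v] norm_triangle_ineq[of "m *\<^sub>R L w" "L r"] m by simp
  then have "m * 1 \<le> m * norm (L w)" using rle by simp
  then have "norm (L w) \<ge> 1" using m by simp
  then show thesis using that v by (simp add: w_def)
qed

section \<open>Extreme contractions from the four-dimensional cube into a plane\<close>

theorem theorem2p15:
  assumes "polygonal TYPE('b::banach)"
  shows "weak_LP_property TYPE(4 linf) TYPE('b)"
proof -
  have dim: "dim (UNIV :: 'b set) = 2" using assms by (simp add: polygonal_def)
  have False
    if ext: "extreme_contraction T" and nT: "norm T = 1"
      and disj: "blinfun_apply T ` Ext (cball 0 1) \<inter> Ext (cball 0 1) = {}"
    for T :: "4 linf \<Rightarrow>\<^sub>L 'b"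
  proof -
    have T: "T extreme_point_of cball 0 1"
      using ext by (simp add: extreme_contraction_def Ext_def)
    define L where "L x = T (of_coords x)" for x
    have L: "linear L" unfolding L_def by (rule linear_blinfun_of_coords)
    have bound: "norm (L x) \<le> 1" if "\<And>i. \<bar>x $ i\<bar> \<le> 1" for x
    proof -
      have "norm (L x) \<le> 1 * norm (of_coords x)"
        unfolding L_def nT[symmetric] by (rule norm_blinfun)
      also have "\<dots> \<le> 1" using that by (simp add: norm_linf_le_iff)
      finally show ?thesis .
    qed
    have sgn_le: "\<bar>v $ i\<bar> = 1" if "v \<in> sign_vectors" for v :: "real ^ 4" and i
      using sign_vectorsD[OF that, of i] by auto
    have "\<exists>d. d \<noteq> 0 \<and> norm (L v + d) \<le> 1 \<and> norm (L v - d) \<le> 1" if v: "v \<in> sign_vectors" for v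
    proof -
      have "\<not> L v extreme_point_of cball 0 1"
        using disj sign_vector_in_Ext[OF v] by (auto simp: L_def Ext_def)
      moreover have "L v \<in> cball 0 1" using bound[of v] sgn_le[OF v] by simp
      ultimately show ?thesis
        using not_extreme_point_of_imp_perturbation[OF convex_cball] by (metis mem_cball_0)
    qed
    then obtain d where d0: "\<And>v. v \<in> sign_vectors \<Longrightarrow> d v \<noteq> 0"
      and d: "\<And>v. v \<in> sign_vectors \<Longrightarrow> norm (L v + d v) \<le> 1"
        "\<And>v. v \<in> sign_vectors \<Longrightarrow> norm (L v - d v) \<le> 1"
      by metis
    have zero: "U x = 0" if "linear U"
      "\<And>v. v \<in> sign_vectors \<Longrightarrow> \<exists>s\<in>{v, - v}. norm (L s) < 1 \<or> (\<exists>c. U s = c *\<^sub>R d s)" for U x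
      by (rule extreme_blinfun_imp_zero[OF T _ that(1), of d])
        (use d that(2) in \<open>simp_all add: L_def\<close>)
    have all1: "norm (L v) = 1" if v: "v \<in> sign_vectors" for v
    proof (rule ccontr)
      assume "norm (L v) \<noteq> 1"
      then have "norm (L v) < 1" using bound[of v] sgn_le[OF v] by fastforce
      then have "norm (L (- v)) < 1" by (simp add: linear_neg[OF L])
      \<comment> \<open>The representative of the pair of \<open>v\<close> in the half
        \<open>H\<close> of the vertices. Its pair imposes no equation, which leaves at most 7
        equations in 8 unknowns.\<close>
      obtain v0 where v0: "v0 \<in> sign_vectors" "v0 $ 1 = 1" "norm (L v0) < 1"
      proof (cases "v $ 1 = 1")
        case True
        then show thesis using that v \<open>norm (L v) < 1\<close> by blast
      next
        case False
        then have "(- v) $ 1 = 1" using sign_vectorsD[OF v, of 1] by simp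
        then show thesis
          using that uminus_sign_vectors[OF v] \<open>norm (L (- v)) < 1\<close> by blast
      qed
      define H :: "(real ^ 4) set" where "H = {v \<in> sign_vectors. v $ 1 = 1}"
      have finH: "finite H"
        by (rule finite_subset[OF _ finite_sign_vectors]) (auto simp: H_def)
      have "v0 \<in> H" using v0 by (simp add: H_def)
      moreover have "card H \<le> 8" using card_sign_vectors_half[where 'n = 4, of 1] by (simp add: H_def)
      ultimately have "card (H - {v0}) < 2 * CARD(4)"
        using finH by (simp add: card_Diff_singleton)
      then obtain U x where U: "linear U" "U x \<noteq> 0"
        "\<And>v. v \<in> H - {v0} \<Longrightarrow> \<exists>c. U v = c *\<^sub>R d v"
        using exists_linear_parallel[OF dim, of "H - {v0}" d] finH d0 by (auto simp: H_def)
      have "U x = 0"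
      proof (rule zero[OF U(1)])
        fix v :: "real ^ 4" assume v: "v \<in> sign_vectors"
        then have "v \<in> H \<or> - v \<in> H"
          using sign_vectorsD[OF v, of 1] uminus_sign_vectors[OF v] by (auto simp: H_def)
        then obtain s where "s \<in> {v, - v}" "s \<in> H" by blast
        then show "\<exists>s\<in>{v, - v}. norm (L s) < 1 \<or> (\<exists>c. U s = c *\<^sub>R d s)"
          using U(3)[of s] v0(3) by blast
      qed
      with U(2) show False by contradiction
    qed
    have card4: "CARD(4) \<ge> 4" by simp
    obtain a i j where a: "i \<noteq> j" "a $ i \<noteq> 0" "a $ j \<noteq> 0" "L a = 0" "\<And>l. \<bar>a $ l\<bar> \<le> 1"
      by (rule exists_kernel_two_nonzero_coordinates[OF dim card4 L]) (rule that; assumption)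
    obtain v where v: "v \<in> sign_vectors"
      and centre: "norm (L (\<chi> l. if l = i \<or> l = j then 0 else v $ l)) \<ge> 1"
      by (rule exists_sign_vector_face_centre[OF L bound all1 a(2-5)])
        (assumption | rule that)+
    define w where "w = (\<chi> l. if l = i \<or> l = j then 0 else v $ l)"
    have "card (UNIV - {i, j}) = 2" using a(1) by (simp add: card_Diff_subset)
    then obtain k l where kl: "UNIV - {i, j} = {k, l}" "k \<noteq> l" by (auto simp: card_2_iff)
    \<comment> \<open>Here \<open>s\<close> is any vertex of the face with centre \<open>w\<close>.
      If the directions were independent, the midpoint of \<open>s\<close> and \<open>v\<close>
      would have an image of norm below 1.\<close>
    have parallel: "\<exists>c. d v = c *\<^sub>R d s"
      if s: "s \<in> sign_vectors" "s $ k = v $ k" "s $ l = v $ l" for s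
    proof (rule ccontr)
      assume "\<nexists>c. d v = c *\<^sub>R d s"
      then have "d v \<notin> range (\<lambda>c. c *\<^sub>R d s)" by blast
      then obtain \<alpha> \<beta> where "L s + L v = \<alpha> *\<^sub>R d s + \<beta> *\<^sub>R d v"
        using two_dim_span[OF dim d0[OF s(1)]] by blast
      then have lt: "norm (L s + L v) < 2"
        by (rule norm_add_less_2[OF d(1)[OF s(1)] d(2)[OF s(1)] d(1)[OF v] d(2)[OF v]])
      \<comment> \<open>The reflection of that midpoint in \<open>w\<close>. It stays in the cube,
        so \<open>L w\<close> would be the mean of a vector of norm below 1 and one of norm at most
        1.\<close>
      define r where "r = 2 *\<^sub>R w - (1/2) *\<^sub>R (s + v)"
      have "\<bar>r $ n\<bar> \<le> 1" for n
      proof (cases "n = i \<or> n = j")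
        case True
        then show ?thesis
          using sign_vectorsD[OF v, of n] sign_vectorsD[OF s(1), of n] by (auto simp: r_def w_def)
      next
        case False
        then have "n = k \<or> n = l" using kl by blast
        then have "s $ n = v $ n" using s by auto
        then show ?thesis
          using False sign_vectorsD[OF v, of n] by (auto simp: r_def w_def)
      qed
      then have "norm (L r) \<le> 1" by (rule bound)
      have "4 *\<^sub>R w = (s + v) + 2 *\<^sub>R r" by (simp add: r_def algebra_simps flip: scaleR_2)
      from arg_cong[OF this, of L] have "4 *\<^sub>R L w = (L s + L v) + 2 *\<^sub>R L r"
        by (simp add: linear_add[OF L] linear_scale[OF L])
      then have "4 * norm (L w) \<le> norm (L s + L v) + 2 * norm (L r)"
        using norm_triangle_ineq[of "L s + L v" "2 *\<^sub>R L r"] norm_scaleR[of 4 "L w"] by simp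
      with lt \<open>norm (L r) \<le> 1\<close> centre show False by (simp add: w_def)
    qed
    define U where "U x = (v $ k * x $ k + v $ l * x $ l) *\<^sub>R d v" for x :: "real ^ 4"
    have linU: "linear U" by (rule linearI) (simp_all add: U_def algebra_simps)
    have "U v = 0"
    proof (rule zero[OF linU])
      fix s :: "real ^ 4" assume s: "s \<in> sign_vectors"
      \<comment> \<open>The products \<open>v $ k * s $ k\<close> and \<open>v $ l * s $ l\<close>
        are both 1, both -1, or cancel.\<close>
      have "s $ k = v $ k \<and> s $ l = v $ l \<or> (- s) $ k = v $ k \<and> (- s) $ l = v $ l
          \<or> v $ k * s $ k + v $ l * s $ l = 0"
        using sign_vectorsD[OF v, of k] sign_vectorsD[OF v, of l]
          sign_vectorsD[OF s, of k] sign_vectorsD[OF s, of l]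
        by (elim disjE) simp_all
      then consider "s $ k = v $ k" "s $ l = v $ l" | "(- s) $ k = v $ k" "(- s) $ l = v $ l"
        | "v $ k * s $ k + v $ l * s $ l = 0"
        by blast
      then have "\<exists>t\<in>{s, - s}. \<exists>c. U t = c *\<^sub>R d t"
      proof cases
        case 1
        then obtain c where "d v = c *\<^sub>R d s" using parallel[OF s] by blast
        then have "U s = ((v $ k * s $ k + v $ l * s $ l) * c) *\<^sub>R d s"
          unfolding U_def by simp
        then show ?thesis by blast
      next
        case 2
        then obtain c where "d v = c *\<^sub>R d (- s)"
          using parallel[OF uminus_sign_vectors[OF s]] by blast
        then have "U (- s) = ((v $ k * (- s) $ k + v $ l * (- s) $ l) * c) *\<^sub>R d (- s)"
          unfolding U_def by simp
        then show ?thesis by blast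
      next
        case 3
        then have "U s = 0 *\<^sub>R d s" by (simp add: U_def)
        then show ?thesis by blast
      qed
      then show "\<exists>t\<in>{s, - s}. norm (L t) < 1 \<or> (\<exists>c. U t = c *\<^sub>R d t)" by blast
    qed
    \<comment> \<open>Hence \<open>U v\<close> is twice the nonzero vector
      \<open>d v\<close>.\<close>
    moreover have "v $ k * v $ k + v $ l * v $ l = 2"
      using sign_vectorsD[OF v, of k] sign_vectorsD[OF v, of l] by auto
    ultimately show False using d0[OF v] by (simp add: U_def)
  qed
  then show ?thesis unfolding weak_LP_property_def by blast
qed

end
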